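(* Let $\ast:[0,1]^2\to[0,1]$ and $\triangle:[0,1]^2\to[0,1]$ be any two binary functions on the unit interval. Then the convolution $\ast_\triangle$ is a t-norm on $(\mathbf{L_u},\sqsubseteq)$ if and only if $\ast$ is a continuous t-norm on $[0,1]$ and $\triangle$ is a right continuous t-norm on $[0,1]$.
   Context: A t-norm on a bounded poset $(P,\le,0_P,1_P)$ is a binary operation $P^2\to P$ that is commutative, associative, monotone ($y\le z$ implies $x\ast y\le x\ast z$), and satisfies $x\ast 1_P=x$. A t-norm $\ast$ on $[0,1]$ is continuous if it is continuous as a function of two variables; it is right continuous if for all monotone decreasing sequences $\{x_n\},\{y_n\}$ in $[0,1]$, $\lim (x_n\ast y_n)=(\lim x_n)\ast(\lim y_n)$. $\mathbf{M}$ is the set of all maps $[0,1]\to[0,1]$ (fuzzy truth values). $f\in\mathbf{M}$ is normal if $\sup_{x\in[0,1]} f(x)=1$; convex if $x\le y\le z$ implies $\min(f(x),f(z))\le f(y)$; upper semicontinuous if $f^\alpha=\{x\in[0,1]\mid f(x)\ge\alpha\}$ is closed for all $\alpha\in[0,1]$. $\mathbf{L_u}$ is the set of all normal, convex, upper semicontinuous $f\in\mathbf{M}$. The convolution induced by $\ast$ and $\triangle$ is the operation $\ast_\triangle:\mathbf{M}^2\to\mathbf{M}$, $(f\ast_\triangle g)(x)=\bigvee_{a\ast b=x} f(a)\,\triangle\, g(b)$, with $\bigvee\varnothing=0$. The convolution order is defined by $f\sqsubseteq g$ iff $f\wedge_\wedge g=f$, where $\wedge_\wedge$ is the convolution with both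 operations equal to $\wedge=\min$. The poset $(\mathbf{L_u},\sqsubseteq)$ is bounded with minimum $\bar 0$ and maximum $\bar 1$, where $\bar c$ denotes the characteristic function of $\{c\}$. "$\ast_\triangle$ is a t-norm on $(\mathbf{L_u},\sqsubseteq)$" means that $\ast_\triangle$ maps $\mathbf{L_u}^2$ into $\mathbf{L_u}$ and its restriction to $\mathbf{L_u}$ is a t-norm on this bounded poset. *)

theory Defs
  imports "HOL-Analysis.Analysis"
begin

text \<open>
  Operations on \<open>[0,1]\<close> are functions of type \<open>real \<Rightarrow> real \<Rightarrow> real\<close> of which only the values on
  \<open>[0,1] \<times> [0,1]\<close> are ever used.  Maps \<open>[0,1] \<rightarrow> [0,1]\<close> are extensional functions
  (\<open>undefined\<close> outside \<open>[0,1]\<close>), so that equality in HOL is equality of maps on \<open>[0,1]\<close>.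
\<close>

definition bounded_poset :: "'a set \<Rightarrow> ('a \<Rightarrow> 'a \<Rightarrow> bool) \<Rightarrow> 'a \<Rightarrow> 'a \<Rightarrow> bool" where
  "bounded_poset P le bt tp \<longleftrightarrow>
     partial_order_on P {(x, y). x \<in> P \<and> y \<in> P \<and> le x y} \<and>
     bt \<in> P \<and> tp \<in> P \<and> (\<forall>x\<in>P. le bt x \<and> le x tp)"

definition tnorm_on ::
  "'a set \<Rightarrow> ('a \<Rightarrow> 'a \<Rightarrow> bool) \<Rightarrow> 'a \<Rightarrow> 'a \<Rightarrow> ('a \<Rightarrow> 'a \<Rightarrow> 'a) \<Rightarrow> bool" where
  "tnorm_on P le bt tp T \<longleftrightarrow>
     bounded_poset P le bt tp \<and>
     (\<forall>x\<in>P. \<forall>y\<in>P. T x y \<in> P) \<and>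
     (\<forall>x\<in>P. \<forall>y\<in>P. T x y = T y x) \<and>
     (\<forall>x\<in>P. \<forall>y\<in>P. \<forall>z\<in>P. T (T x y) z = T x (T y z)) \<and>
     (\<forall>x\<in>P. \<forall>y\<in>P. \<forall>z\<in>P. le y z \<longrightarrow> le (T x y) (T x z)) \<and>
     (\<forall>x\<in>P. T x tp = x)"

abbreviation unit_tnorm :: "(real \<Rightarrow> real \<Rightarrow> real) \<Rightarrow> bool" where
  "unit_tnorm T \<equiv> tnorm_on {0..1} (\<le>) 0 1 T"

definition continuous_tnorm :: "(real \<Rightarrow> real \<Rightarrow> real) \<Rightarrow> bool" where
  "continuous_tnorm T \<longleftrightarrow>
     unit_tnorm T \<and> continuous_on ({0..1} \<times> {0..1}) (\<lambda>(x, y). T x y)"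

definition right_continuous_tnorm :: "(real \<Rightarrow> real \<Rightarrow> real) \<Rightarrow> bool" where
  "right_continuous_tnorm T \<longleftrightarrow>
     unit_tnorm T \<and>
     (\<forall>x y a b. (\<forall>n. x n \<in> {0..1}) \<and> decseq x \<and> x \<longlonglongrightarrow> a \<and>
                (\<forall>n. y n \<in> {0..1}) \<and> decseq y \<and> y \<longlonglongrightarrow> b \<longrightarrow>
                (\<lambda>n. T (x n) (y n)) \<longlonglongrightarrow> T a b)"

definition fuzzy_truth_values :: "(real \<Rightarrow> real) set" where
  "fuzzy_truth_values = {0..1} \<rightarrow>\<^sub>E {0..1}"

definition normal_ftv :: "(real \<Rightarrow> real) \<Rightarrow> bool" where
  "normal_ftv f \<longleftrightarrow> (SUP x\<in>{0..1}. f x) = 1"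

definition convex_ftv :: "(real \<Rightarrow> real) \<Rightarrow> bool" where
  "convex_ftv f \<longleftrightarrow>
     (\<forall>x\<in>{0..1}. \<forall>y\<in>{0..1}. \<forall>z\<in>{0..1}. x \<le> y \<and> y \<le> z \<longrightarrow> min (f x) (f z) \<le> f y)"

definition usc_ftv :: "(real \<Rightarrow> real) \<Rightarrow> bool" where
  "usc_ftv f \<longleftrightarrow> (\<forall>\<alpha>\<in>{0..1}. closedin (top_of_set {0..1}) {x\<in>{0..1}. f x \<ge> \<alpha>})"

definition Lu :: "(real \<Rightarrow> real) set" where
  "Lu = {f \<in> fuzzy_truth_values. normal_ftv f \<and> convex_ftv f \<and> usc_ftv f}"

text \<open>
  The supremum is taken in the complete lattice \<open>[0,1]\<close>, where the empty set has supremum \<open>0\<close>;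
  on \<open>real\<close> this is obtained by adding \<open>0\<close> to the set.
\<close>

definition convolution ::
  "(real \<Rightarrow> real \<Rightarrow> real) \<Rightarrow> (real \<Rightarrow> real \<Rightarrow> real) \<Rightarrow>
   (real \<Rightarrow> real) \<Rightarrow> (real \<Rightarrow> real) \<Rightarrow> (real \<Rightarrow> real)" where
  "convolution star tri f g =
     (\<lambda>x\<in>{0..1}. Sup (insert 0 {tri (f a) (g b) | a b. a \<in> {0..1} \<and> b \<in> {0..1} \<and> star a b = x}))"

definition convolution_le :: "(real \<Rightarrow> real) \<Rightarrow> (real \<Rightarrow> real) \<Rightarrow> bool" where
  "convolution_le f g \<longleftrightarrow> convolution min min f g = f"

definition char_ftv :: "real \<Rightarrow> (real \<Rightarrow> real)" where
  "char_ftv c = restrict (indicator {c}) {0..1}"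

end

theory Submission
  imports Defs
begin

text \<open>
  If \<open>star\<close> is continuous and \<open>tri\<close> right continuous, then \<open>tri (f a) (g b)\<close> is upper
  semicontinuous in \<open>(a, b)\<close>, so by compactness the supremum defining the convolution is attained.
  The t-norm axioms then pass from \<open>star\<close> and \<open>tri\<close> to the convolution pointwise, and the cuts of
  the convolution are images under \<open>star\<close> of compact connected sets.

  Conversely, singletons multiply like their base points, which makes \<open>star\<close> a t-norm; then
  \<open>star a b = 1\<close> only for \<open>a = b = 1\<close>, so evaluation at \<open>1\<close> maps the convolution to \<open>tri\<close> and makes
  \<open>tri\<close> a t-norm.  Convexity of convolutions gives the intermediate value property of \<open>star\<close>, and
  upper semicontinuity at \<open>1\<close> gives right continuity of \<open>tri\<close>; monotonicity turns both properties
  from separate into joint ones.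
\<close>

section \<open>Fuzzy truth values\<close>

lemma ftv_range: "f \<in> fuzzy_truth_values \<Longrightarrow> x \<in> {0..1} \<Longrightarrow> f x \<in> {0..1}"
  by (auto simp: fuzzy_truth_values_def)

lemma ftv_eqI:
  assumes "f \<in> fuzzy_truth_values" "g \<in> fuzzy_truth_values" "\<And>x. x \<in> {0..1} \<Longrightarrow> f x = g x"
  shows "f = g"
  using assms unfolding fuzzy_truth_values_def by (intro PiE_ext) auto

lemma Lu_ftv: "f \<in> Lu \<Longrightarrow> f \<in> fuzzy_truth_values"
  by (simp add: Lu_def)

lemma Lu_range: "f \<in> Lu \<Longrightarrow> x \<in> {0..1} \<Longrightarrow> f x \<in> {0..1}"
  using ftv_range Lu_ftv by blast

lemma Lu_convex:
  "f \<in> Lu \<Longrightarrow> x \<in> {0..1} \<Longrightarrow> z \<in> {0..1} \<Longrightarrow> x \<le> y \<Longrightarrow> y \<le> z \<Longrightarrow> min (f x) (f z) \<le> f y"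
  by (force simp: Lu_def convex_ftv_def)

text \<open>The level is an arbitrary real because levels such as \<open>f a + e\<close> above 1
  occur later. Relative closedness becomes closedness since [0,1] is closed.\<close>

lemma Lu_closed_cut:
  assumes "f \<in> Lu"
  shows "closed {x \<in> {0..1}. c \<le> f x}"
proof -
  consider "c < 0" | "c \<in> {0..1}" | "c > 1" by fastforce
  then show ?thesis
  proof cases
    case 1
    then have "{x \<in> {0..1}. c \<le> f x} = {0..1}"
      using Lu_range[OF assms] by fastforce
    then show ?thesis by (simp add: closed_atLeastAtMost)
  next
    case 2
    then have "closedin (top_of_set {0..1}) {x \<in> {0..1}. c \<le> f x}"
      using assms by (auto simp: Lu_def usc_ftv_def)
    then show ?thesis
      using closedin_closed_eq[of "{0..1::real}"] by auto
  next
    case 3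
    then have "{x \<in> {0..1}. c \<le> f x} = {}"
      using Lu_range[OF assms] by fastforce
    then show ?thesis by (metis closed_empty)
  qed
qed

lemma Lu_connected_cut:
  assumes "f \<in> Lu"
  shows "connected {x \<in> {0..1}. c \<le> f x}"
proof -
  have "is_interval {x \<in> {0..1}. c \<le> f x}"
    unfolding is_interval_1
  proof (intro ballI allI impI)
    fix a b x
    assume "a \<in> {x \<in> {0..1}. c \<le> f x}" "b \<in> {x \<in> {0..1}. c \<le> f x}" "a \<le> x \<and> x \<le> b"
    with Lu_convex[OF assms, of a b x] show "x \<in> {x \<in> {0..1}. c \<le> f x}" by auto
  qed
  then show ?thesis by (simp add: is_interval_connected_1)
qed

lemma LuI:
  assumes f: "f \<in> fuzzy_truth_values" and u: "u \<in> {0..1}" "f u = 1"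
    and convex: "\<And>x y z. x \<in> {0..1} \<Longrightarrow> y \<in> {0..1} \<Longrightarrow> z \<in> {0..1} \<Longrightarrow> x \<le> y \<Longrightarrow> y \<le> z
      \<Longrightarrow> min (f x) (f z) \<le> f y"
    and closed: "\<And>c. 0 < c \<Longrightarrow> c \<le> 1 \<Longrightarrow> closed {x \<in> {0..1}. c \<le> f x}"
  shows "f \<in> Lu"
proof -
  have "(SUP x\<in>{0..1}. f x) = 1"
    using ftv_range[OF f] u by (intro cSup_eq_maximum) force+
  moreover have "closedin (top_of_set {0..1}) {x \<in> {0..1}. c \<le> f x}" if "c \<in> {0..1}" for c
  proof (cases "c = 0")
    case True
    then have "{x \<in> {0..1}. c \<le> f x} = {0..1}"
      using ftv_range[OF f] by fastforce
    then show ?thesis by simp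
  next
    case False
    then show ?thesis
      using that closed[of c] by (auto intro: closed_subset)
  qed
  ultimately show ?thesis
    using f convex unfolding Lu_def normal_ftv_def convex_ftv_def usc_ftv_def by blast
qed

text \<open>Extreme value theorem for upper semicontinuous functions. Without a maximum, the sets
  where \<open>h\<close> is below one of its values cover \<open>S\<close>; the largest value
  indexing a finite subcover is taken at a point that no member covers.\<close>

lemma usc_attains_sup:
  fixes h :: "'a::topological_space \<Rightarrow> real"
  assumes S: "compact S" "S \<noteq> {}" and usc: "\<And>y. y \<in> S \<Longrightarrow> closed {x \<in> S. h y \<le> h x}"
  obtains x where "x \<in> S" "\<And>y. y \<in> S \<Longrightarrow> h y \<le> h x"
proof (rule ccontr)
  assume "\<not> thesis"
  with that have no_max: "\<exists>y\<in>S. h x < h y" if "x \<in> S" for x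
    by (meson \<open>x \<in> S\<close> not_le)
  define U where "U y = - {x \<in> S. h y \<le> h x}" for y
  have "S \<subseteq> (\<Union>y\<in>S. U y)"
    using no_max by (force simp: U_def not_le)
  moreover have "open (U y)" if "y \<in> S" for y
    using usc[OF that] by (simp add: U_def open_Compl)
  ultimately obtain Y where Y: "Y \<subseteq> S" "finite Y" "S \<subseteq> (\<Union>y\<in>Y. U y)"
    using compactE_image[OF S(1), of S U] by metis
  with S have "Y \<noteq> {}" by auto
  then have "Max (h ` Y) \<in> h ` Y" using Y by (intro Max_in) auto
  then obtain m where m: "m \<in> Y" "h m = Max (h ` Y)" by auto
  then obtain y where "y \<in> Y" "m \<in> U y" using Y by auto
  then have "h m < h y" using m Y by (auto simp: U_def)
  moreover have "h y \<le> h m" using m Y \<open>y \<in> Y\<close> by simp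
  ultimately show False by simp
qed

text \<open>By upper semicontinuity and compactness the supremum 1 is a maximum.\<close>

lemma Lu_kernel:
  assumes "f \<in> Lu"
  obtains u where "u \<in> {0..1}" "f u = 1"
proof -
  obtain u where u: "u \<in> {0..1}" "\<And>y. y \<in> {0..1} \<Longrightarrow> f y \<le> f u"
    using usc_attains_sup[of "{0..1}" f] Lu_closed_cut[OF assms] by auto
  then have "(SUP x\<in>{0..1}. f x) = f u"
    by (intro cSup_eq_maximum) auto
  moreover have "(SUP x\<in>{0..1}. f x) = 1"
    using assms by (simp add: Lu_def normal_ftv_def)
  ultimately show ?thesis using that u by auto
qed

text \<open>Convexity holds because \<open>f z\<close> is already at most \<open>f y\<close>. The
  step and linear test functions are of this kind.\<close>

lemma antimono_LuI:
  assumes "f \<in> fuzzy_truth_values" "f 0 = 1"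
    and "\<And>x y. x \<in> {0..1} \<Longrightarrow> y \<in> {0..1} \<Longrightarrow> x \<le> y \<Longrightarrow> f y \<le> f x"
    and "\<And>c. 0 < c \<Longrightarrow> c \<le> 1 \<Longrightarrow> closed {x \<in> {0..1}. c \<le> f x}"
  shows "f \<in> Lu"
  using assms by (intro LuI[where u = 0]) (auto simp: min_le_iff_disj)

section \<open>Test functions: singletons, steps and lines\<close>

lemma char_ftv_apply: "x \<in> {0..1} \<Longrightarrow> char_ftv c x = (if x = c then 1 else 0)"
  by (simp add: char_ftv_def)

lemma char_ftv_Lu:
  assumes "c \<in> {0..1}"
  shows "char_ftv c \<in> Lu"
proof (rule LuI[OF _ assms])
  show "char_ftv c \<in> fuzzy_truth_values"
    by (auto simp: fuzzy_truth_values_def char_ftv_def indicator_def)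
  show "char_ftv c c = 1" using assms by (simp add: char_ftv_apply)
  show "min (char_ftv c x) (char_ftv c z) \<le> char_ftv c y"
    if "x \<in> {0..1}" "y \<in> {0..1}" "z \<in> {0..1}" "x \<le> y" "y \<le> z" for x y z
    using that by (auto simp: char_ftv_apply)
  fix d :: real assume "0 < d" "d \<le> 1"
  then have "{x \<in> {0..1}. d \<le> char_ftv c x} = {c}"
    using assms by (auto simp: char_ftv_apply split: if_splits)
  then show "closed {x \<in> {0..1}. d \<le> char_ftv c x}"
    by (metis closed_singleton)
qed

lemma char_ftv_inject:
  assumes "a \<in> {0..1}" "char_ftv a = char_ftv b"
  shows "a = b"
proof -
  have "char_ftv b a = 1" using assms char_ftv_apply[of a a] by simp
  then show ?thesis using assms(1) by (simp add: char_ftv_apply split: if_splits)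
qed

text \<open>Test function with a freely chosen value \<open>c\<close> at 1, where the convolution
  will reveal \<open>tri\<close>; the value 1 at 0 makes it normal. For \<open>c = 1\<close> it is
  the constant 1.\<close>

definition step_ftv :: "real \<Rightarrow> real \<Rightarrow> real" where
  "step_ftv c = (\<lambda>x\<in>{0..1}. if x = 0 then 1 else c)"

lemma step_ftv_1 [simp]: "step_ftv c 1 = c"
  by (simp add: step_ftv_def)

lemma step_ftv_Lu:
  assumes "c \<in> {0..1}"
  shows "step_ftv c \<in> Lu"
proof (rule antimono_LuI)
  show "step_ftv c \<in> fuzzy_truth_values"
    using assms by (auto simp: fuzzy_truth_values_def step_ftv_def)
  fix d :: real assume "0 < d" "d \<le> 1"
  then have "{x \<in> {0..1}. d \<le> step_ftv c x} = (if d \<le> c then {0..1} else {0})"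
    by (auto simp: step_ftv_def split: if_splits)
  then show "closed {x \<in> {0..1}. d \<le> step_ftv c x}"
    by (simp add: closed_atLeastAtMost)
qed (use assms in \<open>auto simp: step_ftv_def\<close>)

text \<open>The line from 1 at 0 to \<open>c\<close> at 1. For \<open>c < 1\<close> its values
  approach \<open>c\<close> strictly from above as \<open>x\<close> tends to 1, which probes
  \<open>tri\<close> to the right of \<open>c\<close>.\<close>

definition linear_ftv :: "real \<Rightarrow> real \<Rightarrow> real" where
  "linear_ftv c = (\<lambda>x\<in>{0..1}. 1 - x * (1 - c))"

lemma linear_ftv_Lu:
  assumes c: "c \<in> {0..1}"
  shows "linear_ftv c \<in> Lu"
proof (rule antimono_LuI)
  have "0 \<le> x * (1 - c)" "x * (1 - c) \<le> 1" if "x \<in> {0..1}" for x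
    using that c by (auto intro: mult_le_one)
  then show "linear_ftv c \<in> fuzzy_truth_values"
    by (auto simp: fuzzy_truth_values_def linear_ftv_def)
  show "linear_ftv c y \<le> linear_ftv c x"
    if "x \<in> {0..1}" "y \<in> {0..1}" "x \<le> y" for x y
    using that c by (auto simp: linear_ftv_def intro: mult_right_mono)
  fix d :: real
  have "{x \<in> {0..1}. d \<le> linear_ftv c x} = {0..1} \<inter> {x. d \<le> 1 - x * (1 - c)}"
    by (auto simp: linear_ftv_def)
  moreover have "closed {x. d \<le> 1 - x * (1 - c)}"
    by (intro closed_Collect_le continuous_intros)
  ultimately show "closed {x \<in> {0..1}. d \<le> linear_ftv c x}"
    by (metis closed_Int closed_atLeastAtMost)
qed (simp add: linear_ftv_def)


section \<open>Convolutions\<close>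

locale convolution_ops =
  fixes star tri :: "real \<Rightarrow> real \<Rightarrow> real"
  assumes star_range: "\<And>x y. x \<in> {0..1} \<Longrightarrow> y \<in> {0..1} \<Longrightarrow> star x y \<in> {0..1}"
    and tri_range: "\<And>x y. x \<in> {0..1} \<Longrightarrow> y \<in> {0..1} \<Longrightarrow> tri x y \<in> {0..1}"
begin

abbreviation conv :: "(real \<Rightarrow> real) \<Rightarrow> (real \<Rightarrow> real) \<Rightarrow> (real \<Rightarrow> real)" where
  "conv \<equiv> convolution star tri"

context
  fixes f g assumes f: "f \<in> fuzzy_truth_values" and g: "g \<in> fuzzy_truth_values"
begin

lemma tri_le_1: "a \<in> {0..1} \<Longrightarrow> b \<in> {0..1} \<Longrightarrow> tri (f a) (g b) \<le> 1"
  using tri_range[OF ftv_range[OF f] ftv_range[OF g]] by simp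

lemma conv_bdd_above:
  "bdd_above (insert 0 {tri (f a) (g b) | a b. a \<in> {0..1} \<and> b \<in> {0..1} \<and> star a b = x})"
proof (rule bdd_aboveI)
  fix y assume "y \<in> insert 0 {tri (f a) (g b) | a b. a \<in> {0..1} \<and> b \<in> {0..1} \<and> star a b = x}"
  then show "y \<le> 1" using tri_le_1 by (elim insertE CollectE exE conjE) simp_all
qed

lemma conv_upper:
  assumes "a \<in> {0..1}" "b \<in> {0..1}"
  shows "tri (f a) (g b) \<le> conv f g (star a b)"
proof -
  let ?A = "insert 0 {tri (f a') (g b') | a' b'. a' \<in> {0..1} \<and> b' \<in> {0..1} \<and> star a' b' = star a b}"
  have "tri (f a) (g b) \<in> ?A" using assms by blast
  then have "tri (f a) (g b) \<le> Sup ?A" using conv_bdd_above by (rule cSup_upper)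
  then show ?thesis using star_range[OF assms] by (simp add: convolution_def)
qed

lemma conv_nonneg:
  assumes "x \<in> {0..1}"
  shows "0 \<le> conv f g x"
  using cSup_upper[OF insertI1 conv_bdd_above, of x] assms
  by (simp only: convolution_def restrict_apply' if_True)

text \<open>The hypothesis \<open>0 \<le> c\<close> covers the 0 adjoined to the supremum, its value
  when no pair satisfies \<open>star a b = x\<close>.\<close>

lemma conv_least:
  assumes "x \<in> {0..1}" "0 \<le> c"
    and "\<And>a b. a \<in> {0..1} \<Longrightarrow> b \<in> {0..1} \<Longrightarrow> star a b = x \<Longrightarrow> tri (f a) (g b) \<le> c"
  shows "conv f g x \<le> c"
proof -
  have "Sup (insert 0 {tri (f a) (g b) | a b. a \<in> {0..1} \<and> b \<in> {0..1} \<and> star a b = x}) \<le> c"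
    by (rule cSup_least) (use assms in auto)
  then show ?thesis using assms by (simp add: convolution_def)
qed

lemma conv_ftv: "conv f g \<in> fuzzy_truth_values"
proof -
  have "conv f g x \<le> 1" if "x \<in> {0..1}" for x
    by (rule conv_least[OF that]) (simp_all add: tri_le_1)
  then show ?thesis
    using conv_nonneg by (simp add: fuzzy_truth_values_def PiE_iff extensional_def convolution_def)
qed

end

end


section \<open>T-norms on the unit interval\<close>

lemma bounded_poset_unit: "bounded_poset {0..1} (\<le>) 0 (1::real)"
  by (auto simp: bounded_poset_def partial_order_on_def preorder_on_def refl_on_def trans_def antisym_def)

lemma unit_tnormD:
  assumes "unit_tnorm T" "x \<in> {0..1}" "y \<in> {0..1}"
  shows unit_tnorm_range: "T x y \<in> {0..1}"
    and unit_tnorm_commute: "T x y = T y x"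
    and unit_tnorm_assoc: "z \<in> {0..1} \<Longrightarrow> T (T x y) z = T x (T y z)"
    and unit_tnorm_1: "T x 1 = x"
  using assms unfolding tnorm_on_def by blast+

lemma unit_tnorm_mono:
  assumes T: "unit_tnorm T" and "x \<in> {0..1}" "x' \<in> {0..1}" "y \<in> {0..1}" "y' \<in> {0..1}" "x \<le> x'" "y \<le> y'"
  shows "T x y \<le> T x' y'"
proof -
  have "T x y \<le> T x y'" "T y' x \<le> T y' x'"
    using assms unfolding tnorm_on_def by blast+
  then show ?thesis
    using unit_tnorm_commute[OF T] assms by (metis order_trans)
qed

lemma unit_tnorm_le:
  assumes T: "unit_tnorm T" and "x \<in> {0..1}" "y \<in> {0..1}"
  shows "T x y \<le> x" "T x y \<le> y"
proof -
  have *: "T x y \<le> x" if "x \<in> {0..1}" "y \<in> {0..1}" for x y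
    using unit_tnorm_mono[OF T that(1) that(1) that(2), of 1] unit_tnorm_1[OF T that] that by auto
  show "T x y \<le> x" using * assms by blast
  show "T x y \<le> y"
    using *[of y x] unit_tnorm_commute[OF T] assms by metis
qed

lemma unit_tnorm_0:
  assumes "unit_tnorm T" "x \<in> {0..1}"
  shows "T x 0 = 0"
  using unit_tnorm_le(2)[OF assms, of 0] unit_tnorm_range[OF assms, of 0] by auto

text \<open>Right continuity in quantitative form: along \<open>a + 1/(n+1)\<close> and
  \<open>b + 1/(n+1)\<close>, cut off at 1 to stay in [0,1], the values of \<open>T\<close> tend to
  \<open>T a b\<close> and so are eventually below \<open>c\<close>.\<close>

lemma right_continuous_tnorm_strict_upper:
  assumes T: "right_continuous_tnorm T" and "a \<in> {0..1}" "b \<in> {0..1}" "T a b < c"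
  obtains e where "0 < e" "T (min 1 (a + e)) (min 1 (b + e)) < c"
proof -
  define X where "X a n = min 1 (a + 1 / real (Suc n))" for a n
  have "decseq (X a)" for a
    unfolding X_def decseq_def by (intro allI impI min.mono add_mono order_refl divide_left_mono) auto
  moreover have "X a n \<in> {0..1}" if "a \<in> {0..1}" for a n
    using that by (auto simp: X_def)
  moreover have "X a \<longlonglongrightarrow> a" if "a \<in> {0..1}" for a
  proof -
    have "(\<lambda>n. min 1 (a + 1 / real (Suc n))) \<longlonglongrightarrow> min 1 (a + 0)"
      by (intro tendsto_intros LIMSEQ_Suc[OF lim_1_over_n])
    then show ?thesis using that by (simp add: X_def[abs_def])
  qed
  ultimately have "(\<lambda>n. T (X a n) (X b n)) \<longlonglongrightarrow> T a b"
    using T assms(2,3) unfolding right_continuous_tnorm_def by blast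
  then have "\<forall>\<^sub>F n in sequentially. T (X a n) (X b n) < c"
    using assms(4) by (rule order_tendstoD)
  then obtain n where "T (X a n) (X b n) < c"
    by (auto simp: eventually_sequentially)
  then show ?thesis using that[of "1 / real (Suc n)"] by (simp add: X_def)
qed

text \<open>A monotone section that takes every value between 0 and \<open>b\<close> cannot jump, so
  \<open>T\<close> is continuous in each variable; monotonicity then bounds \<open>T\<close> on a
  box by its values at corners.\<close>

lemma unit_tnorm_continuous:
  assumes T: "unit_tnorm T"
    and ivt: "\<And>b y. b \<in> {0..1} \<Longrightarrow> 0 \<le> y \<Longrightarrow> y \<le> b \<Longrightarrow> \<exists>a\<in>{0..1}. T a b = y"
  shows "continuous_tnorm T"
proof -
  note mono = unit_tnorm_mono[OF T] and comm = unit_tnorm_commute[OF T] and range = unit_tnorm_range[OF T]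
  have upper1: "\<exists>d>0. \<forall>r\<in>{0..1}. r < p + d \<longrightarrow> T r q < T p q + e"
    if pq: "p \<in> {0..1}" "q \<in> {0..1}" and e: "0 < e" for p q e
  proof (cases "q < T p q + e")
    case True
    have "T r q < T p q + e" if "r \<in> {0..1}" for r
      using unit_tnorm_le(2)[OF T that pq(2)] True by simp
    then show ?thesis by (intro exI[of _ 1]) auto
  next
    case False
    \<comment> \<open>Here \<open>T p q + e \<le> q\<close>, so the value halfway into the margin is
      attained, and by monotonicity only to the right of \<open>p\<close>.\<close>
    then obtain p' where p': "p' \<in> {0..1}" "T p' q = T p q + e / 2"
      using ivt[OF pq(2), of "T p q + e / 2"] range[OF pq] e by auto
    have "p < p'"
    proof (rule ccontr)
      assume "\<not> p < p'"
      then have "T p' q \<le> T p q" using p' pq by (intro mono) auto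
      then show False using p' e by simp
    qed
    moreover have "T r q < T p q + e" if "r \<in> {0..1}" "r < p + (p' - p)" for r
    proof -
      have "T r q \<le> T p' q" using that p' pq by (intro mono) auto
      then show ?thesis using p' e by simp
    qed
    ultimately show ?thesis by (intro exI[of _ "p' - p"]) auto
  qed
  have lower1: "\<exists>d>0. \<forall>r\<in>{0..1}. p - d < r \<longrightarrow> T p q - e < T r q"
    if pq: "p \<in> {0..1}" "q \<in> {0..1}" and e: "0 < e" for p q e
  proof (cases "T p q < e")
    case True
    have "T p q - e < T r q" if "r \<in> {0..1}" for r
      using range[OF that pq(2)] True by simp
    then show ?thesis by (intro exI[of _ 1]) auto
  next
    case False
    then obtain p' where p': "p' \<in> {0..1}" "T p' q = T p q - e / 2"
      using ivt[OF pq(2), of "T p q - e / 2"] unit_tnorm_le(2)[OF T pq] e by auto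
    have "p' < p"
    proof (rule ccontr)
      assume "\<not> p' < p"
      then have "T p q \<le> T p' q" using p' pq by (intro mono) auto
      then show False using p' e by simp
    qed
    moreover have "T p q - e < T r q" if "r \<in> {0..1}" "p - (p - p') < r" for r
    proof -
      have "T p' q \<le> T r q" using that p' pq by (intro mono) auto
      then show ?thesis using p' e by simp
    qed
    ultimately show ?thesis by (intro exI[of _ "p - p'"]) auto
  qed
  have upper: "\<exists>d>0. \<forall>r\<in>{0..1}. \<forall>s\<in>{0..1}. r < p + d \<longrightarrow> s < q + d \<longrightarrow> T r s < T p q + e"
    if pq: "p \<in> {0..1}" "q \<in> {0..1}" and e: "0 < e" for p q e
  proof -
    obtain d where d: "d > 0" "\<forall>r\<in>{0..1}. r < p + d \<longrightarrow> T r q < T p q + e / 2"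
      using upper1[OF pq, of "e / 2"] e by auto
    \<comment> \<open>One variable at a time: the first argument is frozen at \<open>p'\<close>,
      which dominates every \<open>r\<close> below \<open>p + d / 2\<close>, and the second varies.
      The halving keeps \<open>p'\<close> within the radius \<open>d\<close>.\<close>
    define p' where "p' = min 1 (p + d / 2)"
    have p': "p' \<in> {0..1}" using pq d by (auto simp: p'_def)
    have "p' < p + d" using d by (auto simp: p'_def min_less_iff_disj)
    then have *: "T q p' < T p q + e / 2" using d p' comm pq by metis
    obtain d' where d': "d' > 0" "\<forall>s\<in>{0..1}. s < q + d' \<longrightarrow> T s p' < T q p' + e / 2"
      using upper1[OF pq(2) p', of "e / 2"] e by auto
    have "T r s < T p q + e" if "r \<in> {0..1}" "s \<in> {0..1}" "r < p + d / 2" "s < q + d'" for r s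
    proof -
      have "T r s \<le> T p' s" using that p' by (intro mono) (auto simp: p'_def)
      also have "\<dots> = T s p'" using comm p' that by blast
      also have "\<dots> < T q p' + e / 2" using d' that by blast
      finally show ?thesis using * by simp
    qed
    then show ?thesis using d d' by (intro exI[of _ "min (d / 2) d'"]) auto
  qed
  have lower: "\<exists>d>0. \<forall>r\<in>{0..1}. \<forall>s\<in>{0..1}. p - d < r \<longrightarrow> q - d < s \<longrightarrow> T p q - e < T r s"
    if pq: "p \<in> {0..1}" "q \<in> {0..1}" and e: "0 < e" for p q e
  proof -
    obtain d where d: "d > 0" "\<forall>r\<in>{0..1}. p - d < r \<longrightarrow> T p q - e / 2 < T r q"
      using lower1[OF pq, of "e / 2"] e by auto
    define p' where "p' = max 0 (p - d / 2)"
    have p': "p' \<in> {0..1}" using pq d by (auto simp: p'_def)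
    have "p - d < p'" using d by (auto simp: p'_def less_max_iff_disj)
    then have *: "T p q - e / 2 < T q p'" using d p' comm pq by metis
    obtain d' where d': "d' > 0" "\<forall>s\<in>{0..1}. q - d' < s \<longrightarrow> T q p' - e / 2 < T s p'"
      using lower1[OF pq(2) p', of "e / 2"] e by auto
    have "T p q - e < T r s" if "r \<in> {0..1}" "s \<in> {0..1}" "p - d / 2 < r" "q - d' < s" for r s
    proof -
      have "T q p' - e / 2 < T s p'" using d' that by blast
      also have "\<dots> = T p' s" using comm p' that by blast
      also have "\<dots> \<le> T r s" using that p' by (intro mono) (auto simp: p'_def)
      finally show ?thesis using * by simp
    qed
    then show ?thesis using d d' by (intro exI[of _ "min (d / 2) d'"]) auto
  qed
  have "continuous_on ({0..1} \<times> {0..1}) (\<lambda>(x, y). T x y)"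
    unfolding continuous_on_iff
  proof (clarify)
    fix p q e :: real assume pq: "p \<in> {0..1}" "q \<in> {0..1}" and e: "0 < e"
    obtain d1 where d1: "d1 > 0"
      "\<forall>r\<in>{0..1}. \<forall>s\<in>{0..1}. r < p + d1 \<longrightarrow> s < q + d1 \<longrightarrow> T r s < T p q + e"
      using upper[OF pq e] by blast
    obtain d2 where d2: "d2 > 0"
      "\<forall>r\<in>{0..1}. \<forall>s\<in>{0..1}. p - d2 < r \<longrightarrow> q - d2 < s \<longrightarrow> T p q - e < T r s"
      using lower[OF pq e] by blast
    have "dist (T r s) (T p q) < e"
      if rs: "r \<in> {0..1}" "s \<in> {0..1}" and d: "dist (r, s) (p, q) < min d1 d2" for r s
    proof -
      have "dist r p < min d1 d2" "dist s q < min d1 d2"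
        using d dist_fst_le[of "(r, s)" "(p, q)"] dist_snd_le[of "(r, s)" "(p, q)"] by simp_all
      then have "r < p + d1" "s < q + d1" "p - d2 < r" "q - d2 < s"
        by (auto simp: dist_real_def)
      then have "T r s < T p q + e" "T p q - e < T r s" using d1 d2 rs by blast+
      then show ?thesis by (simp add: dist_real_def abs_less_iff)
    qed
    then show "\<exists>d>0. \<forall>z\<in>{0..1} \<times> {0..1}. dist z (p, q) < d \<longrightarrow>
        dist (case z of (x, y) \<Rightarrow> T x y) (T p q) < e"
      using d1 d2 by (intro exI[of _ "min d1 d2"]) auto
  qed
  with T show ?thesis by (simp add: continuous_tnorm_def)
qed

text \<open>Decreasing sequences stay above their limits, so monotonicity gives the lower bound. For
  the upper bound one \<open>x m\<close> near \<open>a\<close> is frozen while \<open>y n\<close>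
  tends to \<open>b\<close>; from \<open>m\<close> on, \<open>x n\<close> is at most
  \<open>x m\<close>.\<close>

lemma unit_tnorm_right_continuous:
  assumes T: "unit_tnorm T"
    and rc: "\<And>a b c. a \<in> {0..1} \<Longrightarrow> b \<in> {0..1} \<Longrightarrow> T a b < c \<Longrightarrow>
      \<exists>d>0. \<forall>s\<in>{0..1}. s < a + d \<longrightarrow> T s b < c"
  shows "right_continuous_tnorm T"
  unfolding right_continuous_tnorm_def
proof (intro conjI T allI impI, elim conjE)
  fix x y :: "nat \<Rightarrow> real" and a b :: real
  assume x: "\<forall>n. x n \<in> {0..1}" "decseq x" "x \<longlonglongrightarrow> a"
    and y: "\<forall>n. y n \<in> {0..1}" "decseq y" "y \<longlonglongrightarrow> b"
  have a: "a \<in> {0..1}" and b: "b \<in> {0..1}"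
    using closed_sequentially[OF closed_atLeastAtMost] x y by blast+
  have ge: "a \<le> x n" "b \<le> y n" for n
    using x y by (auto intro: decseq_ge)
  show "(\<lambda>n. T (x n) (y n)) \<longlonglongrightarrow> T a b"
  proof (rule order_tendstoI)
    fix c assume "c < T a b"
    moreover have "T a b \<le> T (x n) (y n)" for n
      by (intro unit_tnorm_mono[OF T] a b ge x(1)[rule_format] y(1)[rule_format])
    ultimately show "\<forall>\<^sub>F n in sequentially. c < T (x n) (y n)"
      by (intro always_eventually) (metis less_le_trans)
  next
    fix c assume "T a b < c"
    then obtain d where d: "d > 0" "\<forall>s\<in>{0..1}. s < a + d \<longrightarrow> T s b < c"
      using rc[OF a b] by blast
    have "\<forall>\<^sub>F n in sequentially. x n < a + d"
      using order_tendstoD(2)[OF x(3)] d by simp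
    then obtain m where m: "x m < a + d" by (auto simp: eventually_sequentially)
    have xm: "x m \<in> {0..1}" using x by blast
    have "T b (x m) < c"
      using d m xm unit_tnorm_commute[OF T b xm] by simp
    then obtain e where e: "e > 0" "\<forall>s\<in>{0..1}. s < b + e \<longrightarrow> T s (x m) < c"
      using rc[OF b xm] by blast
    have "\<forall>\<^sub>F n in sequentially. y n < b + e"
      using order_tendstoD(2)[OF y(3)] e by simp
    moreover have "\<forall>\<^sub>F n in sequentially. m \<le> n" by (rule eventually_ge_at_top)
    ultimately show "\<forall>\<^sub>F n in sequentially. T (x n) (y n) < c"
    proof eventually_elim
      case (elim n)
      have I: "x n \<in> {0..1}" "y n \<in> {0..1}" using x y by blast+
      have "T (x n) (y n) \<le> T (x m) (y n)"
        using decseqD[OF x(2) elim(2)] by (intro unit_tnorm_mono[OF T] I xm) auto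
      also have "\<dots> = T (y n) (x m)" using unit_tnorm_commute[OF T xm I(2)] .
      also have "\<dots> < c" using e I elim by blast
      finally show ?case .
    qed
  qed
qed


section \<open>Convolutions of t-norms\<close>

text \<open>Where the value is below \<open>c\<close>, it stays below after both arguments of
  \<open>T\<close> are raised by some \<open>e\<close>, and upper semicontinuity keeps
  \<open>f\<close> and \<open>g\<close> within that margin nearby.\<close>

lemma closed_tnorm_cut:
  assumes T: "right_continuous_tnorm T" and f: "f \<in> Lu" and g: "g \<in> Lu"
  shows "closed {(a, b) \<in> {0..1} \<times> {0..1}. c \<le> T (f a) (g b)}" (is "closed ?K")
proof -
  have T': "unit_tnorm T" using T by (simp add: right_continuous_tnorm_def)
  have "\<exists>U. open U \<and> z \<in> U \<and> U \<subseteq> - ?K" if z: "z \<in> - ?K" for z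
  proof (cases "z \<in> {0..1} \<times> {0..1}")
    case False
    have "open (- ({0..1::real} \<times> {0..1::real}))"
      by (intro open_Compl closed_Times closed_atLeastAtMost)
    with False show ?thesis by blast
  next
    case True
    then obtain a b where ab: "z = (a, b)" "a \<in> {0..1}" "b \<in> {0..1}" by auto
    with z have "T (f a) (g b) < c" by auto
    then obtain e where e: "0 < e" "T (min 1 (f a + e)) (min 1 (g b + e)) < c"
      using right_continuous_tnorm_strict_upper[OF T] Lu_range[OF f] Lu_range[OF g] ab by metis
    \<comment> \<open>In the unit square, points of this open rectangle satisfy
      \<open>f x < f a + e\<close> and \<open>g y < g b + e\<close>; points outside the square are
      never in \<open>?K\<close>.\<close>
    let ?U = "(- {x \<in> {0..1}. f a + e \<le> f x}) \<times> (- {x \<in> {0..1}. g b + e \<le> g x})"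
    have "open ?U"
      by (intro open_Times open_Compl Lu_closed_cut f g)
    moreover have "z \<in> ?U" using ab e by auto
    moreover have "T (f x) (g y) < c"
      if xy: "x \<in> {0..1}" "y \<in> {0..1}" and U: "(x, y) \<in> ?U" for x y
    proof -
      have "f a \<in> {0..1}" "g b \<in> {0..1}" "f x \<in> {0..1}" "g y \<in> {0..1}"
        using Lu_range[OF f] Lu_range[OF g] ab xy by blast+
      then have "T (f x) (g y) \<le> T (min 1 (f a + e)) (min 1 (g b + e))"
        using xy U e by (intro unit_tnorm_mono[OF T']) auto
      with e show ?thesis by simp
    qed
    then have "?U \<subseteq> - ?K" by fastforce
    ultimately show ?thesis by blast
  qed
  then have "open (- ?K)" by (subst open_subopen) blast
  then show ?thesis by (simp only: closed_def)
qed

locale tnorm_pair =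
  fixes star tri :: "real \<Rightarrow> real \<Rightarrow> real"
  assumes star: "continuous_tnorm star" and tri: "right_continuous_tnorm tri"
begin

lemma star_tnorm: "unit_tnorm star"
  using star by (simp add: continuous_tnorm_def)

lemma tri_tnorm: "unit_tnorm tri"
  using tri by (simp add: right_continuous_tnorm_def)

sublocale convolution_ops star tri
  using unit_tnorm_range[OF star_tnorm] unit_tnorm_range[OF tri_tnorm] by unfold_locales

lemma conv_attained:
  assumes f: "f \<in> Lu" and g: "g \<in> Lu" and x: "x \<in> {0..1}"
  obtains a b where "a \<in> {0..1}" "b \<in> {0..1}" "star a b = x" "conv f g x = tri (f a) (g b)"
proof -
  let ?I = "{0..1::real} \<times> {0..1::real}"
  let ?h = "\<lambda>z. tri (f (fst z)) (g (snd z))"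
  define S where "S = {z \<in> ?I. star (fst z) (snd z) = x}"
  have "S = ?I \<inter> (\<lambda>(a, b). star a b) -` {x}" by (auto simp: S_def)
  moreover have "closed (?I \<inter> (\<lambda>(a, b). star a b) -` {x})"
    using star unfolding continuous_tnorm_def
    by (intro continuous_closed_preimage closed_Times closed_singleton closed_atLeastAtMost) simp_all
  ultimately have "closed S" by simp
  moreover have "?I \<inter> S = S" by (auto simp: S_def)
  ultimately have S: "compact S"
    using compact_Int_closed[OF compact_Times[OF compact_Icc compact_Icc], of S 0 1 0 1] by simp
  \<comment> \<open>The unit law makes every fibre of \<open>star\<close> nonempty; as the attained
    value is nonnegative, the adjoined 0 does not raise the supremum.\<close>
  have "(x, 1) \<in> S"
    using x unit_tnorm_1[OF star_tnorm] by (auto simp: S_def)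
  moreover have "closed {z \<in> S. c \<le> ?h z}" for c
  proof -
    have "{z \<in> S. c \<le> ?h z} = S \<inter> {(a, b) \<in> ?I. c \<le> tri (f a) (g b)}" by (auto simp: S_def)
    then show ?thesis
      using closed_Int[OF compact_imp_closed[OF S] closed_tnorm_cut[OF tri f g]] by simp
  qed
  ultimately obtain z where z: "z \<in> S" "\<And>y. y \<in> S \<Longrightarrow> ?h y \<le> ?h z"
    using usc_attains_sup[OF S, of ?h] by blast
  obtain a b where ab: "z = (a, b)" by (cases z)
  have I: "a \<in> {0..1}" "b \<in> {0..1}" "star a b = x" using z by (auto simp: S_def ab)
  have "f a \<in> {0..1}" "g b \<in> {0..1}" using Lu_range f g I by blast+
  then have "0 \<le> tri (f a) (g b)" using tri_range by fastforce
  then have "conv f g x \<le> tri (f a) (g b)"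
    using z(2) x by (intro conv_least Lu_ftv f g) (auto simp: S_def ab)
  moreover have "tri (f a) (g b) \<le> conv f g x"
    using conv_upper[OF Lu_ftv Lu_ftv, OF f g I(1,2)] I by simp
  ultimately have "conv f g x = tri (f a) (g b)" by simp
  with I show ?thesis by (rule that)
qed

lemma conv_Lu:
  assumes f: "f \<in> Lu" and g: "g \<in> Lu"
  shows "conv f g \<in> Lu"
proof -
  obtain u v where u: "u \<in> {0..1}" "f u = 1" and v: "v \<in> {0..1}" "g v = 1"
    using Lu_kernel f g by metis
  have cont: "continuous_on ({0..1} \<times> {0..1}) (\<lambda>(a, b). star a b)"
    using star by (simp add: continuous_tnorm_def)
  have upper: "tri (f a) (g b) \<le> conv f g (star a b)" if "a \<in> {0..1}" "b \<in> {0..1}" for a b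
    using conv_upper[OF Lu_ftv Lu_ftv, OF f g that] .
  have range: "f x \<in> {0..1}" "g x \<in> {0..1}" if "x \<in> {0..1}" for x
    using Lu_range f g that by blast+
  show ?thesis
  proof (rule LuI)
    show ftv: "conv f g \<in> fuzzy_truth_values"
      using conv_ftv[OF Lu_ftv Lu_ftv, OF f g] .
    show uv: "star u v \<in> {0..1}" using star_range u v by simp
    have "tri 1 1 \<le> conv f g (star u v)" using upper[OF u(1) v(1)] u v by simp
    then show "conv f g (star u v) = 1"
      using unit_tnorm_1[OF tri_tnorm, of 1 1] ftv_range[OF ftv uv] by simp
  next
    fix x y z :: real
    assume xyz: "x \<in> {0..1}" "y \<in> {0..1}" "z \<in> {0..1}" "x \<le> y" "y \<le> z"
    obtain a b where ab: "a \<in> {0..1}" "b \<in> {0..1}" "star a b = x" "conv f g x = tri (f a) (g b)"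
      using conv_attained[OF f g xyz(1)] .
    obtain c d where cd: "c \<in> {0..1}" "d \<in> {0..1}" "star c d = z" "conv f g z = tri (f c) (g d)"
      using conv_attained[OF f g xyz(3)] .
    \<comment> \<open>The rectangles of points at least as good as \<open>(a, b)\<close> and as \<open>(c, d)\<close> meet in \<open>(u, v)\<close>.\<close>
    define R where "R a b = {p \<in> {0..1}. f a \<le> f p} \<times> {q \<in> {0..1}. g b \<le> g q}" for a b
    have "connected (R a b)" "connected (R c d)"
      unfolding R_def by (intro connected_Times Lu_connected_cut f g)+
    moreover have "(u, v) \<in> R a b \<inter> R c d"
      using u v range ab cd by (auto simp: R_def)
    ultimately have "connected (R a b \<union> R c d)" by (intro connected_Un) auto
    then have "connected ((\<lambda>(a, b). star a b) ` (R a b \<union> R c d))"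
      by (intro connected_continuous_image continuous_on_subset[OF cont]) (auto simp: R_def)
    moreover have "x \<in> (\<lambda>(a, b). star a b) ` (R a b \<union> R c d)"
      using ab by (force simp: R_def)
    moreover have "z \<in> (\<lambda>(a, b). star a b) ` (R a b \<union> R c d)"
      using cd by (force simp: R_def)
    ultimately have "y \<in> (\<lambda>(a, b). star a b) ` (R a b \<union> R c d)"
      by (rule connectedD_interval) (use xyz in auto)
    then obtain p q where pq: "y = star p q" "(p, q) \<in> R a b \<or> (p, q) \<in> R c d" by auto
    have I: "p \<in> {0..1}" "q \<in> {0..1}" using pq by (auto simp: R_def)
    have "conv f g x \<le> tri (f p) (g q) \<or> conv f g z \<le> tri (f p) (g q)"
      using pq(2)
    proof
      assume "(p, q) \<in> R a b"
      then have "tri (f a) (g b) \<le> tri (f p) (g q)"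
        by (intro unit_tnorm_mono[OF tri_tnorm] range ab(1,2)) (auto simp: R_def)
      with ab show ?thesis by simp
    next
      assume "(p, q) \<in> R c d"
      then have "tri (f c) (g d) \<le> tri (f p) (g q)"
        by (intro unit_tnorm_mono[OF tri_tnorm] range cd(1,2)) (auto simp: R_def)
      with cd show ?thesis by simp
    qed
    with upper[OF I] pq(1) show "min (conv f g x) (conv f g z) \<le> conv f g y" by auto
  next
    fix c :: real assume c: "0 < c" "c \<le> 1"
    let ?K = "{(a, b) \<in> {0..1} \<times> {0..1}. c \<le> tri (f a) (g b)}"
    \<comment> \<open>Attainment makes the cut an exact image: a supremum of at least
      \<open>c\<close> comes from a pair whose value is at least \<open>c\<close>.\<close>
    have "{x \<in> {0..1}. c \<le> conv f g x} = (\<lambda>(a, b). star a b) ` ?K"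
    proof (intro equalityI subsetI)
      fix x assume "x \<in> {x \<in> {0..1}. c \<le> conv f g x}"
      then have x: "x \<in> {0..1}" "c \<le> conv f g x" by auto
      obtain a b where "a \<in> {0..1}" "b \<in> {0..1}" "star a b = x" "conv f g x = tri (f a) (g b)"
        using conv_attained[OF f g x(1)] .
      with x show "x \<in> (\<lambda>(a, b). star a b) ` ?K"
        by (intro image_eqI[of _ _ "(a, b)"]) simp_all
    next
      fix x assume "x \<in> (\<lambda>(a, b). star a b) ` ?K"
      then obtain a b where "a \<in> {0..1}" "b \<in> {0..1}" "c \<le> tri (f a) (g b)" "x = star a b" by auto
      with upper[of a b] star_range[of a b] show "x \<in> {x \<in> {0..1}. c \<le> conv f g x}" by auto
    qed
    moreover have "compact ((\<lambda>(a, b). star a b) ` ?K)"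
    proof (rule compact_continuous_image)
      show "continuous_on ?K (\<lambda>(a, b). star a b)"
        by (rule continuous_on_subset[OF cont]) auto
      have "({0..1} \<times> {0..1}) \<inter> ?K = ?K" by auto
      then show "compact ?K"
        using compact_Int_closed[OF compact_Times[OF compact_Icc compact_Icc] closed_tnorm_cut[OF tri f g],
            of 0 1 0 1 c] by simp
    qed
    ultimately have "compact {x \<in> {0..1}. c \<le> conv f g x}" by simp
    then show "closed {x \<in> {0..1}. c \<le> conv f g x}" by (rule compact_imp_closed)
  qed
qed

lemma conv_commute:
  assumes f: "f \<in> Lu" and g: "g \<in> Lu"
  shows "conv f g = conv g f"
proof (rule ftv_eqI)
  show "conv f g \<in> fuzzy_truth_values" "conv g f \<in> fuzzy_truth_values"
    using conv_Lu f g Lu_ftv by blast+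
  have "conv f g x \<le> conv g f x" if f: "f \<in> Lu" and g: "g \<in> Lu" and x: "x \<in> {0..1}" for f g x
  proof -
    obtain a b where ab: "a \<in> {0..1}" "b \<in> {0..1}" "star a b = x" "conv f g x = tri (f a) (g b)"
      using conv_attained[OF f g x] .
    have "tri (f a) (g b) = tri (g b) (f a)"
      using unit_tnorm_commute[OF tri_tnorm] Lu_range f g ab by blast
    also have "\<dots> \<le> conv g f (star b a)"
      using conv_upper[OF Lu_ftv Lu_ftv, OF g f] ab by blast
    also have "star b a = x"
      using unit_tnorm_commute[OF star_tnorm] ab by metis
    finally show ?thesis using ab by simp
  qed
  then show "conv f g x = conv g f x" if "x \<in> {0..1}" for x
    using f g that by (meson antisym)
qed

text \<open>Attaining both suprema gives \<open>a\<close>, \<open>b\<close>, \<open>c\<close> with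
  value \<open>tri (tri (f a) (g b)) (h c)\<close>; regrouping \<open>tri\<close> and
  \<open>star\<close> turns it into a lower bound for the other bracketing.\<close>

lemma conv_assoc:
  assumes f: "f \<in> Lu" and g: "g \<in> Lu" and h: "h \<in> Lu"
  shows "conv (conv f g) h = conv f (conv g h)"
proof (rule ftv_eqI)
  show "conv (conv f g) h \<in> fuzzy_truth_values" "conv f (conv g h) \<in> fuzzy_truth_values"
    using conv_Lu f g h Lu_ftv by blast+
  have upper: "tri (f a) (g b) \<le> conv f g (star a b)"
    if "f \<in> Lu" "g \<in> Lu" "a \<in> {0..1}" "b \<in> {0..1}" for f g a b
    using conv_upper Lu_ftv that by blast
  have le: "conv (conv f g) h x \<le> conv f (conv g h) x"
    if f: "f \<in> Lu" and g: "g \<in> Lu" and h: "h \<in> Lu" and x: "x \<in> {0..1}" for f g h x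
  proof -
    obtain p c where pc: "p \<in> {0..1}" "c \<in> {0..1}" "star p c = x"
      "conv (conv f g) h x = tri (conv f g p) (h c)"
      using conv_attained[OF conv_Lu[OF f g] h x] .
    obtain a b where ab: "a \<in> {0..1}" "b \<in> {0..1}" "star a b = p" "conv f g p = tri (f a) (g b)"
      using conv_attained[OF f g pc(1)] .
    have bc: "star b c \<in> {0..1}" using star_range ab pc by blast
    have I: "f a \<in> {0..1}" "g b \<in> {0..1}" "h c \<in> {0..1}"
      using Lu_range[OF f ab(1)] Lu_range[OF g ab(2)] Lu_range[OF h pc(2)] .
    have I': "tri (g b) (h c) \<in> {0..1}" "conv g h (star b c) \<in> {0..1}"
      using tri_range[OF I(2,3)] Lu_range[OF conv_Lu[OF g h] bc] .
    have "tri (tri (f a) (g b)) (h c) = tri (f a) (tri (g b) (h c))"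
      using unit_tnorm_assoc[OF tri_tnorm] I by blast
    also have "\<dots> \<le> tri (f a) (conv g h (star b c))"
      using upper[OF g h ab(2) pc(2)] by (intro unit_tnorm_mono[OF tri_tnorm] I I' order_refl)
    also have "\<dots> \<le> conv f (conv g h) (star a (star b c))"
      using upper f conv_Lu g h ab bc by blast
    also have "star a (star b c) = x"
      using unit_tnorm_assoc[OF star_tnorm] ab pc by metis
    finally show ?thesis using ab pc by simp
  qed
  \<comment> \<open>By commutativity, the converse inequality is the same one with \<open>f\<close> and \<open>h\<close> exchanged.\<close>
  fix x :: real assume x: "x \<in> {0..1}"
  have "conv (conv h g) f = conv f (conv g h)" "conv h (conv g f) = conv (conv f g) h"
    using conv_commute conv_Lu f g h by metis+
  then show "conv (conv f g) h x = conv f (conv g h) x"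
    using le[OF f g h x] le[OF h g f x] by simp
qed

text \<open>A pair with \<open>b\<close> different from 1 contributes
  \<open>tri (f a) 0 = 0\<close>; a pair with \<open>b = 1\<close> has \<open>a = x\<close> and
  contributes \<open>f x\<close>.\<close>

lemma conv_char_ftv_1:
  assumes f: "f \<in> Lu"
  shows "conv f (char_ftv 1) = f"
proof (rule ftv_eqI[OF _ Lu_ftv[OF f]])
  have 1: "char_ftv 1 \<in> Lu" by (simp add: char_ftv_Lu)
  then show "conv f (char_ftv 1) \<in> fuzzy_truth_values"
    using conv_Lu f Lu_ftv by blast
  fix x :: real assume x: "x \<in> {0..1}"
  show "conv f (char_ftv 1) x = f x"
  proof (rule antisym)
    show "conv f (char_ftv 1) x \<le> f x"
    proof (rule conv_least[OF Lu_ftv Lu_ftv, OF f 1 x])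
      show "0 \<le> f x" using Lu_range[OF f x] by simp
      fix a b :: real assume ab: "a \<in> {0..1}" "b \<in> {0..1}" "star a b = x"
      have fa: "f a \<in> {0..1}" using Lu_range[OF f ab(1)] .
      show "tri (f a) (char_ftv 1 b) \<le> f x"
      proof (cases "b = 1")
        case True
        then show ?thesis
          using ab unit_tnorm_1[OF star_tnorm ab(1,2)] unit_tnorm_1[OF tri_tnorm fa fa]
          by (simp add: char_ftv_apply)
      next
        case False
        then show ?thesis
          using ab \<open>0 \<le> f x\<close> unit_tnorm_0[OF tri_tnorm fa] by (simp add: char_ftv_apply)
      qed
    qed
    have "tri (f x) (char_ftv 1 1) \<le> conv f (char_ftv 1) (star x 1)"
      using conv_upper[OF Lu_ftv Lu_ftv, OF f 1 x, of 1] by simp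
    then show "f x \<le> conv f (char_ftv 1) x"
      using unit_tnorm_1[OF star_tnorm x x] unit_tnorm_1[OF tri_tnorm Lu_range Lu_range, OF f x f x]
      by (simp add: char_ftv_apply)
  qed
qed

end


section \<open>The convolution order\<close>

lemma min_tnorm: "unit_tnorm min"
  using bounded_poset_unit by (auto simp: tnorm_on_def min_def)

text \<open>The convolution that defines the order is thus itself an instance, with attained suprema
  and commutativity.\<close>

interpretation min: tnorm_pair min min
proof
  have "continuous_on ({0..1} \<times> {0..1}) (\<lambda>z::real \<times> real. min (fst z) (snd z))"
    by (intro continuous_intros)
  then show "continuous_tnorm min"
    using min_tnorm by (simp add: continuous_tnorm_def case_prod_beta')
  show "right_continuous_tnorm min"
    using min_tnorm by (auto simp: right_continuous_tnorm_def intro: tendsto_min)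
qed

text \<open>In terms of the interval-valued cuts, the two conjuncts compare the right and the left
  endpoints, respectively.\<close>

lemma convolution_le_iff:
  assumes f: "f \<in> Lu" and g: "g \<in> Lu"
  shows "convolution_le f g \<longleftrightarrow>
    (\<forall>a\<in>{0..1}. \<exists>b\<in>{0..1}. a \<le> b \<and> f a \<le> g b) \<and>
    (\<forall>b\<in>{0..1}. \<exists>a\<in>{0..1}. a \<le> b \<and> g b \<le> f a)" (is "_ \<longleftrightarrow> ?up \<and> ?down")
proof (intro iffI conjI)
  assume "convolution_le f g"
  then have eq: "min.conv f g = f" by (simp add: convolution_le_def)
  show ?up
  proof
    fix a :: real assume "a \<in> {0..1}"
    with min.conv_attained[OF f g this] eq
    show "\<exists>b\<in>{0..1}. a \<le> b \<and> f a \<le> g b" by (metis min.cobounded2)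
  qed
  show ?down
  proof
    fix b :: real assume b: "b \<in> {0..1}"
    obtain u where u: "u \<in> {0..1}" "f u = 1" using Lu_kernel[OF f] .
    have gb: "g b \<le> 1" using Lu_range[OF g b] by simp
    show "\<exists>a\<in>{0..1}. a \<le> b \<and> g b \<le> f a"
    proof (cases "u \<le> b")
      case True
      with u gb show ?thesis by auto
    next
      case False
      \<comment> \<open>Here \<open>b < u\<close>, so the pair \<open>(u, b)\<close> has minimum
        \<open>b\<close> and contributes \<open>min 1 (g b) = g b\<close> to the convolution at
        \<open>b\<close>, which is \<open>f b\<close>.\<close>
      then have "g b \<le> f b"
        using min.conv_upper[OF Lu_ftv Lu_ftv, OF f g u(1) b] u gb by (simp add: eq)
      with b show ?thesis by auto
    qed
  qed
next
  assume ud: "?up \<and> ?down"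
  have "min.conv f g = f"
  proof (rule ftv_eqI[OF min.conv_ftv])
    fix x :: real assume x: "x \<in> {0..1}"
    show "min.conv f g x = f x"
    proof (rule antisym)
      show "min.conv f g x \<le> f x"
      proof (rule min.conv_least[OF Lu_ftv Lu_ftv, OF f g x])
        show "0 \<le> f x" using Lu_range[OF f x] by simp
        fix a b :: real assume ab: "a \<in> {0..1}" "b \<in> {0..1}" "min a b = x"
        show "min (f a) (g b) \<le> f x"
        proof (cases "a \<le> b")
          case True
          with ab show ?thesis by auto
        next
          case False
          with ab have bx: "b = x" "x \<le> a" by auto
          \<comment> \<open>Now \<open>x\<close> lies between \<open>a'\<close> and
            \<open>a\<close>, so convexity gives \<open>min (f a') (f a) \<le> f x\<close>, and
            \<open>f a'\<close> is at least \<open>g x\<close>.\<close>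
          obtain a' where a': "a' \<in> {0..1}" "a' \<le> x" "g x \<le> f a'" using ud x by blast
          then show ?thesis using Lu_convex[OF f a'(1) ab(1) a'(2) bx(2)] bx by auto
        qed
      qed
      obtain b where b: "b \<in> {0..1}" "x \<le> b" "f x \<le> g b" using ud x by blast
      then show "f x \<le> min.conv f g x"
        using min.conv_upper[OF Lu_ftv Lu_ftv, OF f g x b(1)] by (simp add: min_absorb1)
    qed
  qed (use f g Lu_ftv in auto)
  then show "convolution_le f g" by (simp add: convolution_le_def)
qed

text \<open>Reflexivity and transitivity are read off the pointwise criterion; antisymmetry is
  commutativity of the \<open>min\<close> convolution. For the bounds, a kernel point of
  \<open>f\<close> answers the one point where a singleton has value 1.\<close>

lemma convolution_le_bounded_poset: "bounded_poset Lu convolution_le (char_ftv 0) (char_ftv 1)"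
proof -
  have "convolution_le f f" if "f \<in> Lu" for f
    using that by (auto simp: convolution_le_iff)
  moreover have "convolution_le f h"
    if "f \<in> Lu" "g \<in> Lu" "h \<in> Lu" "convolution_le f g" "convolution_le g h" for f g h
  proof -
    have up: "\<forall>a\<in>{0..1}. \<exists>b\<in>{0..1}. a \<le> b \<and> f a \<le> g b" "\<forall>a\<in>{0..1}. \<exists>b\<in>{0..1}. a \<le> b \<and> g a \<le> h b"
      and down: "\<forall>b\<in>{0..1}. \<exists>a\<in>{0..1}. a \<le> b \<and> g b \<le> f a" "\<forall>b\<in>{0..1}. \<exists>a\<in>{0..1}. a \<le> b \<and> h b \<le> g a"
      using that by (simp_all add: convolution_le_iff)
    show ?thesis
      unfolding convolution_le_iff[OF that(1,3)]
      using up down by (meson order_trans)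
  qed
  moreover have "f = g" if "f \<in> Lu" "g \<in> Lu" "convolution_le f g" "convolution_le g f" for f g
    using that min.conv_commute[OF that(1,2)] by (simp add: convolution_le_def)
  moreover have 01: "char_ftv 0 \<in> Lu" "char_ftv 1 \<in> Lu" by (simp_all add: char_ftv_Lu)
  moreover have "convolution_le (char_ftv 0) f \<and> convolution_le f (char_ftv 1)" if f: "f \<in> Lu" for f
  proof -
    obtain u where u: "u \<in> {0..1}" "f u = 1" using Lu_kernel[OF f] .
    have range: "0 \<le> f x" "f x \<le> 1" if "x \<in> {0..1}" for x
      using Lu_range[OF f that] by auto
    have "\<exists>b\<in>{0..1}. a \<le> b \<and> char_ftv 0 a \<le> f b" if "a \<in> {0..1}" for a
      by (rule bexI[of _ "if a = 0 then u else a"]) (use that u range in \<open>auto simp: char_ftv_apply\<close>)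
    moreover have "\<exists>a\<in>{0..1}. a \<le> b \<and> f b \<le> char_ftv 0 a" if "b \<in> {0..1}" for b
      by (rule bexI[of _ 0]) (use that range in \<open>auto simp: char_ftv_apply\<close>)
    moreover have "\<exists>b\<in>{0..1}. a \<le> b \<and> f a \<le> char_ftv 1 b" if "a \<in> {0..1}" for a
      by (rule bexI[of _ 1]) (use that range in \<open>auto simp: char_ftv_apply\<close>)
    moreover have "\<exists>a\<in>{0..1}. a \<le> b \<and> char_ftv 1 b \<le> f a" if "b \<in> {0..1}" for b
      by (rule bexI[of _ "if b = 1 then u else b"]) (use that u range in \<open>auto simp: char_ftv_apply\<close>)
    ultimately show ?thesis
      unfolding convolution_le_iff[OF 01(1) f] convolution_le_iff[OF f 01(2)] by blast
  qed
  ultimately show ?thesis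
    unfolding bounded_poset_def partial_order_on_def preorder_on_def refl_on_def trans_def antisym_def
    by blast
qed

section \<open>The order on test functions and at the point 1\<close>

lemma convolution_le_char_ftv:
  assumes "a \<in> {0..1}" "b \<in> {0..1}"
  shows "convolution_le (char_ftv a) (char_ftv b) \<longleftrightarrow> a \<le> b"
proof
  assume "convolution_le (char_ftv a) (char_ftv b)"
  then obtain c where "c \<in> {0..1}" "a \<le> c" "char_ftv a a \<le> char_ftv b c"
    using assms convolution_le_iff[OF char_ftv_Lu char_ftv_Lu] by blast
  with assms show "a \<le> b" by (auto simp: char_ftv_apply split: if_splits)
next
  assume "a \<le> b"
  then have "\<exists>d\<in>{0..1}. c \<le> d \<and> char_ftv a c \<le> char_ftv b d" if "c \<in> {0..1}" for c
    by (intro bexI[of _ "if c = a then b else c"]) (use that assms in \<open>auto simp: char_ftv_apply\<close>)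
  moreover have "\<exists>c\<in>{0..1}. c \<le> d \<and> char_ftv b d \<le> char_ftv a c" if "d \<in> {0..1}" for d
    by (intro bexI[of _ "if d = b then a else d"])
      (use that assms \<open>a \<le> b\<close> in \<open>auto simp: char_ftv_apply\<close>)
  ultimately show "convolution_le (char_ftv a) (char_ftv b)"
    using convolution_le_iff[OF char_ftv_Lu char_ftv_Lu] assms by blast
qed

text \<open>No point of [0,1] other than 1 lies above 1, so the first half of the criterion compares
  the values there.\<close>

lemma convolution_le_at_1:
  assumes "f \<in> Lu" "g \<in> Lu" "convolution_le f g"
  shows "f 1 \<le> g 1"
proof -
  have "\<forall>a\<in>{0..1}. \<exists>b\<in>{0..1}. a \<le> b \<and> f a \<le> g b"
    using assms(3) unfolding convolution_le_iff[OF assms(1,2)] ..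
  from bspec[OF this, of 1] obtain b where "b \<in> {0..1}" "1 \<le> b" "f 1 \<le> g b" by auto
  then show ?thesis by (simp add: antisym)
qed

text \<open>This will transfer monotonicity to \<open>tri\<close>. In the second half of the
  criterion 0 is always a witness, since step functions are 1 there.\<close>

lemma convolution_le_step_ftv:
  assumes I: "a \<in> {0..1}" "b \<in> {0..1}" and "a \<le> b"
  shows "convolution_le (step_ftv a) (step_ftv b)"
proof -
  have "\<exists>y\<in>{0..1}. x \<le> y \<and> step_ftv a x \<le> step_ftv b y" if "x \<in> {0..1}" for x
    by (rule bexI[of _ x]) (use that assms in \<open>auto simp: step_ftv_def\<close>)
  moreover have "\<exists>x\<in>{0..1}. x \<le> y \<and> step_ftv b y \<le> step_ftv a x" if "y \<in> {0..1}" for y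
    by (rule bexI[of _ 0]) (use that assms in \<open>auto simp: step_ftv_def\<close>)
  ultimately show ?thesis
    using convolution_le_iff[OF step_ftv_Lu step_ftv_Lu, OF I] by blast
qed

context tnorm_pair
begin

text \<open>Each half of the criterion comes from the same half for \<open>g\<close> and
  \<open>h\<close>: in an attaining pair the second component is exchanged for its witness, which
  moves \<open>star\<close> the right way and does not decrease \<open>tri\<close>.\<close>

lemma conv_mono:
  assumes f: "f \<in> Lu" and g: "g \<in> Lu" and h: "h \<in> Lu" and le: "convolution_le g h"
  shows "convolution_le (conv f g) (conv f h)"
proof -
  have up: "\<And>b. b \<in> {0..1} \<Longrightarrow> \<exists>c\<in>{0..1}. b \<le> c \<and> g b \<le> h c"
    and down: "\<And>c. c \<in> {0..1} \<Longrightarrow> \<exists>b\<in>{0..1}. b \<le> c \<and> h c \<le> g b"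
    using le unfolding convolution_le_iff[OF g h] by simp_all
  have tri_le: "tri (f a) (k b) \<le> conv f l (star a c)"
    if "k \<in> Lu" "l \<in> Lu" "a \<in> {0..1}" "b \<in> {0..1}" "c \<in> {0..1}" "k b \<le> l c" for k l a b c
  proof -
    have "tri (f a) (k b) \<le> tri (f a) (l c)"
      using Lu_range[OF f that(3)] Lu_range[OF that(1,4)] Lu_range[OF that(2,5)] that(6)
      by (intro unit_tnorm_mono[OF tri_tnorm]) simp_all
    also have "\<dots> \<le> conv f l (star a c)"
      using conv_upper Lu_ftv f that by blast
    finally show ?thesis .
  qed
  have "\<exists>y\<in>{0..1}. x \<le> y \<and> conv f g x \<le> conv f h y" if x: "x \<in> {0..1}" for x
  proof -
    obtain a b where ab: "a \<in> {0..1}" "b \<in> {0..1}" "star a b = x" "conv f g x = tri (f a) (g b)"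
      using conv_attained[OF f g x] .
    obtain c where c: "c \<in> {0..1}" "b \<le> c" "g b \<le> h c" using up[OF ab(2)] by blast
    have "x \<le> star a c"
      using unit_tnorm_mono[OF star_tnorm ab(1) ab(1) ab(2) c(1)] c ab by simp
    then show ?thesis
      using tri_le[OF g h ab(1,2) c(1,3)] star_range[OF ab(1) c(1)] ab by auto
  qed
  moreover have "\<exists>x\<in>{0..1}. x \<le> y \<and> conv f h y \<le> conv f g x" if y: "y \<in> {0..1}" for y
  proof -
    obtain a c where ac: "a \<in> {0..1}" "c \<in> {0..1}" "star a c = y" "conv f h y = tri (f a) (h c)"
      using conv_attained[OF f h y] .
    obtain b where b: "b \<in> {0..1}" "b \<le> c" "h c \<le> g b" using down[OF ac(2)] by blast
    have "star a b \<le> y"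
      using unit_tnorm_mono[OF star_tnorm ac(1) ac(1) b(1) ac(2)] b ac by simp
    then show ?thesis
      using tri_le[OF h g ac(1,2) b(1,3)] star_range[OF ac(1) b(1)] ac by auto
  qed
  ultimately show ?thesis
    unfolding convolution_le_iff[OF conv_Lu conv_Lu, OF f g f h] by simp
qed

lemma conv_tnorm: "tnorm_on Lu convolution_le (char_ftv 0) (char_ftv 1) conv"
  unfolding tnorm_on_def
  by (intro conjI ballI impI convolution_le_bounded_poset conv_Lu conv_commute conv_assoc conv_mono
      conv_char_ftv_1)

end


section \<open>Factors of a t-norm convolution\<close>

locale tnorm_convolution = convolution_ops +
  assumes conv_tnorm: "tnorm_on Lu convolution_le (char_ftv 0) (char_ftv 1) (convolution star tri)"
begin

lemma conv_Lu: "f \<in> Lu \<Longrightarrow> g \<in> Lu \<Longrightarrow> conv f g \<in> Lu"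
  and conv_commute: "f \<in> Lu \<Longrightarrow> g \<in> Lu \<Longrightarrow> conv f g = conv g f"
  and conv_assoc: "f \<in> Lu \<Longrightarrow> g \<in> Lu \<Longrightarrow> h \<in> Lu \<Longrightarrow> conv (conv f g) h = conv f (conv g h)"
  and conv_mono: "f \<in> Lu \<Longrightarrow> g \<in> Lu \<Longrightarrow> h \<in> Lu \<Longrightarrow> convolution_le g h \<Longrightarrow>
    convolution_le (conv f g) (conv f h)"
  and conv_1: "f \<in> Lu \<Longrightarrow> conv f (char_ftv 1) = f"
  using conv_tnorm unfolding tnorm_on_def by blast+

lemma conv_upper_Lu:
  assumes "f \<in> Lu" "g \<in> Lu" "a \<in> {0..1}" "b \<in> {0..1}"
  shows "tri (f a) (g b) \<le> conv f g (star a b)"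
  using conv_upper[OF Lu_ftv Lu_ftv] assms by blast

text \<open>Two-sided neutrality of \<open>char_ftv 1\<close> fixes these values before any law of
  \<open>star\<close> is known: convolving \<open>char_ftv a\<close> with it gives 0 off
  \<open>a\<close>, so a pair whose product differs from \<open>a\<close> contributes at most
  0.\<close>

lemma tri_corners: "tri 0 0 = 0" "tri 0 1 = 0" "tri 1 0 = 0" "tri 1 1 = 1"
proof -
  have 1: "char_ftv 1 \<in> Lu" by (simp add: char_ftv_Lu)
  have vanish: "tri (char_ftv a p) (char_ftv 1 q) \<le> 0" "tri (char_ftv 1 q) (char_ftv a p) \<le> 0"
    if "a \<in> {0..1}" "p \<in> {0..1}" "q \<in> {0..1}" "star p q \<noteq> a" "star q p \<noteq> a" for a p q
  proof -
    have "conv (char_ftv a) (char_ftv 1) = char_ftv a" "conv (char_ftv 1) (char_ftv a) = char_ftv a"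
      using conv_1 conv_commute 1 char_ftv_Lu[OF that(1)] by metis+
    then show "tri (char_ftv a p) (char_ftv 1 q) \<le> 0" "tri (char_ftv 1 q) (char_ftv a p) \<le> 0"
      using conv_upper_Lu[OF char_ftv_Lu[OF that(1)] 1 that(2,3)]
        conv_upper_Lu[OF 1 char_ftv_Lu[OF that(1)] that(3,2)] star_range that
      by (simp_all add: char_ftv_apply)
  qed
  have avoid: "\<exists>a\<in>{0..1::real}. a \<noteq> p \<and> a \<noteq> q \<and> a \<noteq> r" for p q r
  proof -
    have "infinite ({0..1::real} - {p, q, r})" by (simp add: infinite_Icc)
    then show ?thesis by (metis DiffE ex_in_conv finite.emptyI insertCI)
  qed
  \<comment> \<open>As \<open>a\<close> is not 0, both singletons vanish at 0; as \<open>a\<close>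
    is not \<open>star 0 0\<close>, the pair \<open>(0, 0)\<close> falls under
    \<open>vanish\<close>.\<close>
  obtain a where a: "a \<in> {0..1}" "a \<noteq> 0" "a \<noteq> star 0 0" using avoid by metis
  then show 00: "tri 0 0 = 0"
    using vanish(1)[of a 0 0] tri_range[of 0 0] by (simp add: char_ftv_apply)
  obtain a where a: "a \<in> {0..1}" "a \<noteq> 0" "a \<noteq> star 0 1" "a \<noteq> star 1 0" using avoid by metis
  then show 01: "tri 0 1 = 0" and 10: "tri 1 0 = 0"
    using vanish[of a 0 1] tri_range[of 0 1] tri_range[of 1 0] by (simp_all add: char_ftv_apply)
  \<comment> \<open>The zeros at the other corners bound this convolution at 1 by
    \<open>tri 1 1\<close>, while neutrality makes it 1.\<close>
  have "conv (char_ftv 1) (char_ftv 1) 1 \<le> tri 1 1"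
    by (rule conv_least[OF Lu_ftv Lu_ftv, OF 1 1])
      (use tri_range[of 1 1] 00 01 10 in \<open>auto simp: char_ftv_apply\<close>)
  then show "tri 1 1 = 1"
    using conv_1[OF 1] tri_range[of 1 1] by (simp add: char_ftv_apply)
qed

text \<open>The pair \<open>(a, b)\<close> contributes \<open>tri 1 1 = 1\<close>; any other pair
  meets one of the corners with value 0.\<close>

lemma conv_char_ftv:
  assumes a: "a \<in> {0..1}" and b: "b \<in> {0..1}"
  shows "conv (char_ftv a) (char_ftv b) = char_ftv (star a b)"
proof (rule ftv_eqI)
  note Lu = char_ftv_Lu[OF a] char_ftv_Lu[OF b]
  show "conv (char_ftv a) (char_ftv b) \<in> fuzzy_truth_values" "char_ftv (star a b) \<in> fuzzy_truth_values"
    using conv_Lu[OF Lu] char_ftv_Lu[OF star_range[OF a b]] Lu_ftv by blast+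
  fix x :: real assume x: "x \<in> {0..1}"
  have "conv (char_ftv a) (char_ftv b) x \<le> char_ftv (star a b) x"
    by (rule conv_least[OF Lu_ftv Lu_ftv, OF Lu x])
      (use x tri_corners in \<open>auto simp: char_ftv_apply\<close>)
  moreover have "char_ftv (star a b) x \<le> conv (char_ftv a) (char_ftv b) x"
  proof (cases "x = star a b")
    case True
    then show ?thesis
      using conv_upper_Lu[OF Lu a b] a b x tri_corners by (simp add: char_ftv_apply)
  next
    case False
    then show ?thesis
      using conv_nonneg[OF Lu_ftv Lu_ftv, OF Lu x] x by (simp add: char_ftv_apply)
  qed
  ultimately show "conv (char_ftv a) (char_ftv b) x = char_ftv (star a b) x" by simp
qed

lemma star_tnorm: "unit_tnorm star"
  unfolding tnorm_on_def
proof (intro conjI ballI impI bounded_poset_unit star_range)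
  fix x y z :: real
  assume x: "x \<in> {0..1}" and y: "y \<in> {0..1}"
  have "char_ftv (star x y) = char_ftv (star y x)"
    using conv_commute[OF char_ftv_Lu char_ftv_Lu, OF x y] by (simp only: conv_char_ftv x y)
  then show "star x y = star y x"
    by (rule char_ftv_inject[OF star_range[OF x y]])
  assume z: "z \<in> {0..1}"
  have "char_ftv (star (star x y) z) = char_ftv (star x (star y z))"
    using conv_assoc[OF char_ftv_Lu char_ftv_Lu char_ftv_Lu, OF x y z]
    by (simp only: conv_char_ftv x y z star_range)
  then show "star (star x y) z = star x (star y z)"
    by (rule char_ftv_inject[OF star_range[OF star_range[OF x y] z]])
  assume "y \<le> z"
  then have "convolution_le (char_ftv (star x y)) (char_ftv (star x z))"
    using conv_mono[OF char_ftv_Lu char_ftv_Lu char_ftv_Lu, OF x y z]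
    by (simp only: convolution_le_char_ftv conv_char_ftv x y z)
  then show "star x y \<le> star x z"
    using convolution_le_char_ftv[OF star_range star_range, OF x y x z] by blast
next
  fix x :: real assume x: "x \<in> {0..1}"
  have "char_ftv (star x 1) = char_ftv x"
    using conv_1[OF char_ftv_Lu[OF x]] conv_char_ftv[OF x, of 1] by simp
  then show "star x 1 = x"
    by (intro char_ftv_inject star_range x) simp_all
qed

lemma conv_at_1:
  assumes f: "f \<in> Lu" and g: "g \<in> Lu"
  shows "conv f g 1 = tri (f 1) (g 1)"
proof (rule antisym)
  have I: "f 1 \<in> {0..1}" "g 1 \<in> {0..1}" using Lu_range f g by auto
  show "conv f g 1 \<le> tri (f 1) (g 1)"
  proof (rule conv_least[OF Lu_ftv Lu_ftv, OF f g])
    fix a b :: real assume ab: "a \<in> {0..1}" "b \<in> {0..1}" "star a b = 1"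
    \<comment> \<open>A product is at most each of its factors.\<close>
    then have "a = 1" "b = 1" using unit_tnorm_le[OF star_tnorm ab(1,2)] by auto
    then show "tri (f a) (g b) \<le> tri (f 1) (g 1)" by simp
  qed (use tri_range[OF I] in auto)
  show "tri (f 1) (g 1) \<le> conv f g 1"
    using conv_upper_Lu[OF f g, of 1 1] unit_tnorm_1[OF star_tnorm, of 1 1] by simp
qed

lemma tri_tnorm: "unit_tnorm tri"
  unfolding tnorm_on_def
proof (intro conjI ballI impI bounded_poset_unit tri_range)
  \<comment> \<open>Every \<open>x\<close> in [0,1] is the value of a step function at 1, so laws of
    the convolution evaluated there become laws of \<open>tri\<close>.\<close>
  have tri_eq: "tri x y = conv (step_ftv x) (step_ftv y) 1" if "x \<in> {0..1}" "y \<in> {0..1}" for x y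
    using conv_at_1[OF step_ftv_Lu step_ftv_Lu, OF that] by simp
  fix x y z :: real
  assume x: "x \<in> {0..1}" and y: "y \<in> {0..1}"
  show "tri x y = tri y x"
    using conv_commute[OF step_ftv_Lu step_ftv_Lu, OF x y] x y by (simp add: tri_eq)
  assume z: "z \<in> {0..1}"
  note Lu = step_ftv_Lu[OF x] step_ftv_Lu[OF y] step_ftv_Lu[OF z]
  have "conv (conv (step_ftv x) (step_ftv y)) (step_ftv z) 1
      = conv (step_ftv x) (conv (step_ftv y) (step_ftv z)) 1"
    using conv_assoc[OF Lu] by simp
  then show "tri (tri x y) z = tri x (tri y z)"
    using Lu by (simp add: conv_at_1 conv_Lu)
  assume "y \<le> z"
  then show "tri x y \<le> tri x z"
    using convolution_le_at_1[OF conv_Lu conv_Lu conv_mono[OF Lu convolution_le_step_ftv[OF y z]]] Lu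
    by (simp add: conv_at_1)
next
  fix x :: real assume x: "x \<in> {0..1}"
  have "tri x 1 = conv (step_ftv x) (char_ftv 1) 1"
    using conv_at_1[OF step_ftv_Lu[OF x] char_ftv_Lu] by (simp add: char_ftv_apply)
  then show "tri x 1 = x" using conv_1[OF step_ftv_Lu[OF x]] by simp
qed

text \<open>Continuity of \<open>star\<close> is forced by convexity: the convolution of the constant \<open>1\<close> with a
  singleton \<open>b\<close> is the characteristic function of the range of \<open>\<lambda>a. star a b\<close>.\<close>

lemma star_continuous: "continuous_tnorm star"
proof (rule unit_tnorm_continuous[OF star_tnorm])
  fix b y :: real assume b: "b \<in> {0..1}" and y: "0 \<le> y" "y \<le> b"
  have Lu: "step_ftv 1 \<in> Lu" "char_ftv b \<in> Lu" using b by (simp_all add: step_ftv_Lu char_ftv_Lu)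
  let ?h = "conv (step_ftv 1) (char_ftv b)"
  have h: "1 \<le> ?h (star a b)" if "a \<in> {0..1}" for a
    using conv_upper_Lu[OF Lu that b] that b tri_corners by (simp add: char_ftv_apply step_ftv_def)
  have 0: "star 0 b = 0"
    using unit_tnorm_0[OF star_tnorm b] unit_tnorm_commute[OF star_tnorm b, of 0] by simp
  have 1: "star 1 b = b"
    using unit_tnorm_1[OF star_tnorm b b] unit_tnorm_commute[OF star_tnorm b, of 1] by simp
  \<comment> \<open>\<open>?h\<close> is at least 1 at \<open>star 0 b = 0\<close> and at
    \<open>star 1 b = b\<close>; convexity fills the interval between.\<close>
  have "1 \<le> ?h y"
    using Lu_convex[OF conv_Lu[OF Lu], of 0 b y] h[of 0] h[of 1] y b by (simp add: 0 1)
  show "\<exists>a\<in>{0..1}. star a b = y"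
  proof (rule ccontr)
    assume no: "\<not> (\<exists>a\<in>{0..1}. star a b = y)"
    \<comment> \<open>Any pair with product \<open>y\<close> would have second component different
      from \<open>b\<close> and contribute \<open>tri 1 0 = 0\<close>.\<close>
    have "?h y \<le> 0"
      by (rule conv_least[OF Lu_ftv Lu_ftv, OF Lu])
        (use y b no tri_corners in \<open>auto simp: char_ftv_apply step_ftv_def\<close>)
    with \<open>1 \<le> ?h y\<close> show False by simp
  qed
qed

text \<open>Right continuity of \<open>tri\<close> is forced by upper semicontinuity at \<open>1\<close>, where the
  convolution reduces to \<open>tri\<close>.\<close>

lemma tri_right_continuous: "right_continuous_tnorm tri"
proof (rule unit_tnorm_right_continuous[OF tri_tnorm], rule ccontr)
  fix a b c :: real
  assume a: "a \<in> {0..1}" and b: "b \<in> {0..1}" and less: "tri a b < c"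
    and "\<not> (\<exists>d>0. \<forall>s\<in>{0..1}. s < a + d \<longrightarrow> tri s b < c)"
  then have ge: "\<exists>s\<in>{0..1}. s < a + d \<and> c \<le> tri s b" if "d > 0" for d
    using that by (meson not_less)
  let ?f = "linear_ftv a" and ?g = "step_ftv b"
  let ?h = "conv ?f ?g"
  have Lu: "?f \<in> Lu" "?g \<in> Lu" using a b by (simp_all add: linear_ftv_Lu step_ftv_Lu)
  \<comment> \<open>For \<open>a = 1\<close>, monotonicity would give
    \<open>tri s b \<le> tri a b < c\<close>. With \<open>a < 1\<close> the line stays strictly
    above \<open>a\<close> before 1.\<close>
  have "a < 1"
  proof (rule ccontr)
    assume "\<not> a < 1"
    with a have "a = 1" by simp
    obtain s where s: "s \<in> {0..1}" "c \<le> tri s b" using ge[of 1] by auto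
    have "tri s b \<le> tri a b"
      using \<open>a = 1\<close> s b by (intro unit_tnorm_mono[OF tri_tnorm]) auto
    with s less show False by simp
  qed
  have cut: "x \<in> {x \<in> {0..1}. c \<le> ?h x}" if x: "0 \<le> x" "x < 1" for x
  proof -
    \<comment> \<open>The line exceeds \<open>a\<close> by exactly this margin at \<open>x\<close>,
      so it dominates some \<open>s\<close> with \<open>c \<le> tri s b\<close>; the pair
      \<open>(x, 1)\<close> carries the bound to \<open>?h x\<close>.\<close>
    have "0 < (1 - x) * (1 - a)" using x \<open>a < 1\<close> by simp
    then obtain s where s: "s \<in> {0..1}" "s < a + (1 - x) * (1 - a)" "c \<le> tri s b"
      using ge by blast
    have fx: "?f x = a + (1 - x) * (1 - a)" using x by (simp add: linear_ftv_def algebra_simps)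
    have "?f x \<in> {0..1}" using Lu_range[OF Lu(1)] x by simp
    then have "tri s b \<le> tri (?f x) b"
      using s b fx by (intro unit_tnorm_mono[OF tri_tnorm]) auto
    also have "\<dots> \<le> ?h x"
      using conv_upper_Lu[OF Lu, of x 1] unit_tnorm_1[OF star_tnorm, of x x] x by simp
    finally show ?thesis using s x by simp
  qed
  \<comment> \<open>The closed cut contains every \<open>x\<close> in [0,1) and therefore 1, where
    \<open>?h\<close> equals \<open>tri a b\<close>.\<close>
  have "closed {x \<in> {0..1}. c \<le> ?h x}" by (rule Lu_closed_cut[OF conv_Lu[OF Lu]])
  moreover have "(\<lambda>n. 1 - 1 / real (Suc n)) \<longlonglongrightarrow> 1 - 0"
    by (intro tendsto_intros LIMSEQ_Suc[OF lim_1_over_n])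
  ultimately have "1 - 0 \<in> {x \<in> {0..1}. c \<le> ?h x}"
    using cut by (elim closed_sequentially) auto
  then have "c \<le> tri (?f 1) (?g 1)" using conv_at_1[OF Lu] by simp
  with less show False by (simp add: linear_ftv_def)
qed

end

theorem theorem3p1:
  fixes star tri :: "real \<Rightarrow> real \<Rightarrow> real"
  assumes star: "\<And>x y. x \<in> {0..1} \<Longrightarrow> y \<in> {0..1} \<Longrightarrow> star x y \<in> {0..1}"
    and tri: "\<And>x y. x \<in> {0..1} \<Longrightarrow> y \<in> {0..1} \<Longrightarrow> tri x y \<in> {0..1}"
  shows "tnorm_on Lu convolution_le (char_ftv 0) (char_ftv 1) (convolution star tri) \<longleftrightarrow>
         continuous_tnorm star \<and> right_continuous_tnorm tri"
proof
  assume "tnorm_on Lu convolution_le (char_ftv 0) (char_ftv 1) (convolution star tri)"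
  with star tri interpret tnorm_convolution star tri by unfold_locales
  show "continuous_tnorm star \<and> right_continuous_tnorm tri"
    using star_continuous tri_right_continuous by simp
next
  assume "continuous_tnorm star \<and> right_continuous_tnorm tri"
  then interpret tnorm_pair star tri by unfold_locales auto
  show "tnorm_on Lu convolution_le (char_ftv 0) (char_ftv 1) (convolution star tri)"
    by (rule conv_tnorm)
qed

end
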